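(* There is a one-round proof labeling scheme for $\textsc{Trapezoid-Recognition}$ with certificates of size $\mathcal{O}(\log n)$; that is, a proof labeling scheme deciding whether the connected $n$-node network $G$ is a trapezoid graph, in which every certificate has $\mathcal{O}(\log n)$ bits.
   Context: A trapezoid graph is the intersection graph of a family of trapezoids each having one side on a fixed top horizontal line and one side on a fixed parallel bottom horizontal line (each trapezoid is the convex hull of two points on the top line and two points on the bottom line). $\textsc{Trapezoid-Recognition}$ is the set of configurations $\langle G,\mathrm{id}\rangle$ with $G$ a trapezoid graph. Distributed setting: $G$ is a simple connected $n$-node graph, each node has a unique identifier in $\{1,\dots,\mathrm{poly}(n)\}$, nodes know only a polynomial upper bound on $n$. A proof labeling scheme (one-round, $\mathsf{dM}$) consists of an untrusted prover assigning each node $v$ a certificate $c(v)$, followed by one deterministic verification round in which each node sees its own id and certificate and the certificates (and ids) of its neighbors and accepts or rejects. Completeness: if $G$ is in the class, some certificate assignment makes all nodes accept. Soundness: if $G$ is not in the class, for every certificate assignment at least one node rejects. Its size is the maximum certificate length in bits. *)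

theory Defs
  imports "HOL-Analysis.Analysis"
begin

definition simple_connected_graph :: "nat set \<Rightarrow> (nat \<Rightarrow> nat \<Rightarrow> bool) \<Rightarrow> bool" where
  "simple_connected_graph V E \<longleftrightarrow>
     finite V \<and> V \<noteq> {} \<and>
     (\<forall>u v. E u v \<longrightarrow> u \<in> V \<and> v \<in> V) \<and>
     (\<forall>u v. E u v \<longrightarrow> E v u) \<and>
     (\<forall>v. \<not> E v v) \<and>
     (\<forall>u\<in>V. \<forall>v\<in>V. E\<^sup>*\<^sup>* u v)"

definition trapezoid :: "real \<Rightarrow> real \<Rightarrow> real \<Rightarrow> real \<Rightarrow> (real \<times> real) set" where
  "trapezoid a b c d = convex hull {(a, 1), (b, 1), (c, 0), (d, 0)}"

definition trapezoid_graph :: "nat set \<Rightarrow> (nat \<Rightarrow> nat \<Rightarrow> bool) \<Rightarrow> bool" where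
  "trapezoid_graph V E \<longleftrightarrow>
     (\<exists>a b c d :: nat \<Rightarrow> real.
        \<forall>u\<in>V. \<forall>v\<in>V. u \<noteq> v \<longrightarrow>
          (E u v \<longleftrightarrow> trapezoid (a u) (b u) (c u) (d u) \<inter> trapezoid (a v) (b v) (c v) (d v) \<noteq> {}))"

text \<open>A verifier receives: the known upper bound N on n, the node's own identifier,
  its own certificate, and the set of (identifier, certificate) pairs of its neighbours.\<close>
type_synonym verifier = "nat \<Rightarrow> nat \<Rightarrow> bool list \<Rightarrow> (nat \<times> bool list) set \<Rightarrow> bool"

definition nbr_view :: "(nat \<Rightarrow> nat \<Rightarrow> bool) \<Rightarrow> (nat \<Rightarrow> nat) \<Rightarrow> (nat \<Rightarrow> bool list) \<Rightarrow> nat \<Rightarrow> (nat \<times> bool list) set" where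
  "nbr_view E idf cert v = {(idf w, cert w) | w. E v w}"

definition all_accept :: "verifier \<Rightarrow> nat \<Rightarrow> nat set \<Rightarrow> (nat \<Rightarrow> nat \<Rightarrow> bool) \<Rightarrow> (nat \<Rightarrow> nat) \<Rightarrow> (nat \<Rightarrow> bool list) \<Rightarrow> bool" where
  "all_accept ver N V E idf cert \<longleftrightarrow> (\<forall>v\<in>V. ver N (idf v) (cert v) (nbr_view E idf cert v))"

definition admissible :: "nat \<Rightarrow> nat set \<Rightarrow> (nat \<Rightarrow> nat \<Rightarrow> bool) \<Rightarrow> (nat \<Rightarrow> nat) \<Rightarrow> nat \<Rightarrow> bool" where
  "admissible k V E idf N \<longleftrightarrow>
     simple_connected_graph V E \<and> inj_on idf V \<and>
     (\<forall>v\<in>V. idf v \<in> {1 .. (card V + 1) ^ k}) \<and>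
     card V \<le> N \<and> N \<le> (card V + 1) ^ k"

end

theory Submission
  imports Defs
begin

text \<open>
  After perturbation, the \<open>2n\<close> endpoints on each line occupy the positions \<open>1, \<dots>, 2n\<close> bijectively,
  and two trapezoids are disjoint iff one is before the other on both lines. A certificate carries the
  four positions of a node together with data proving to the network that these form bijections.

  All nodes holding a position inside the top interval of \<open>v\<close> are neighbours of \<open>v\<close>, so \<open>v\<close> checks
  that none of these positions is missing. At a gap of the top line covered by no trapezoid,
  connectedness yields two adjacent nodes, one on either side, that see the positions up to
  the gap and from the gap on, respectively. Hence all positions \<open>1, \<dots>, 2n\<close> occur; as a spanning tree
  certifies \<open>n\<close>, each occurs once. Nonneighbours then have disjoint intervals on each line.

  Finally \<open>v\<close> computes, by subtracting its neighbours' endpoints, how many endpoints of nonneighbours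
  lie to its left on either line, and checks that the two numbers agree. If some nonadjacent pair
  crossed, take \<open>v\<close> in such a pair with leftmost top interval: its crossing nonneighbours would all be
  to the right on top and to the left on the bottom, so the two numbers would differ.
\<close>

section \<open>Intersecting trapezoids\<close>

lemma trapezoid_sort:
  "trapezoid a b c d = trapezoid (min a b) (max a b) (min c d) (max c d)"
  unfolding trapezoid_def by (intro arg_cong[where f = "\<lambda>S. convex hull S"]) (auto simp: min_def max_def)

text \<open>Each inequality defines a half-plane that contains the four corners and hence their
  convex hull.\<close>

lemma trapezoid_bounds:
  assumes "(x, y) \<in> trapezoid a b c d" "a \<le> b" "c \<le> d"
  shows "0 \<le> y" "y \<le> 1" "a * y + c * (1 - y) \<le> x" "x \<le> b * y + d * (1 - y)"
proof -
  have halfspace: "(x, y) \<in> {p. inner (i, j) p \<ge> e}"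
    if "{(a, 1), (b, 1), (c, 0), (d, 0)} \<subseteq> {p :: real \<times> real. inner (i, j) p \<ge> e}" for i j e
    using hull_minimal[of _ _ convex, OF that convex_halfspace_ge] assms(1)
    unfolding trapezoid_def by blast
  show "0 \<le> y" using halfspace[of 0 0 1] by simp
  show "y \<le> 1" using halfspace[of "-1" 0 "-1"] by simp
  show "a * y + c * (1 - y) \<le> x"
    using halfspace[of c 1 "c - a"] assms(2,3) by (simp add: algebra_simps)
  show "x \<le> b * y + d * (1 - y)"
    using halfspace[of "-d" "-1" "b - d"] assms(2,3) by (simp add: algebra_simps)
qed

lemma trapezoid_contains:
  assumes "0 \<le> y" "y \<le> 1" "p \<in> {a, b}" "q \<in> {c, d}"
  shows "(p * y + q * (1 - y), y) \<in> trapezoid a b c d"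
proof -
  have "y *\<^sub>R (p, 1) + (1 - y) *\<^sub>R (q, 0) \<in> trapezoid a b c d"
    unfolding trapezoid_def using assms
    by (intro convexD convex_convex_hull hull_inc) auto
  then show ?thesis by (simp add: algebra_simps)
qed

text \<open>Two segments from the top to the bottom line whose ends are in weakly opposite orders
  meet, and each lies in its trapezoid because it joins two corners.\<close>

lemma trapezoids_meet_if_crossing:
  assumes "p \<in> {a, b}" "q \<in> {c, d}" "p' \<in> {a', b'}" "q' \<in> {c', d'}" "p \<le> p'" "q' \<le> q"
  shows "trapezoid a b c d \<inter> trapezoid a' b' c' d' \<noteq> {}"
proof -
  \<comment> \<open>\<open>y\<close> is the height at which both segments have the same abscissa.
    The denominator of the solution vanishes only if the segments coincide.\<close>
  obtain y where y: "0 \<le> y" "y \<le> 1" "y * (p' - p) = (1 - y) * (q - q')"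
  proof (cases "p' - p + (q - q') = 0")
    case True
    with assms(5,6) show ?thesis by (intro that[of 0]) auto
  next
    case False
    with assms(5,6) have "p' - p + (q - q') > 0" by linarith
    with assms(5,6) show ?thesis
      by (intro that[of "(q - q') / (p' - p + (q - q'))"]) (auto simp: field_simps)
  qed
  have "p * y + q * (1 - y) = p' * y + q' * (1 - y)" using y(3) by (simp add: algebra_simps)
  then show ?thesis
    using trapezoid_contains[OF y(1,2) assms(1,2)] trapezoid_contains[OF y(1,2) assms(3,4)] by auto
qed


lemma trapezoids_disjoint_if_separated:
  assumes "a \<le> b" "c \<le> d" "a' \<le> b'" "c' \<le> d'" "b < a'" "d < c'"
  shows "trapezoid a b c d \<inter> trapezoid a' b' c' d' = {}"
proof (intro equals0I, elim IntE)
  fix p assume p: "p \<in> trapezoid a b c d" "p \<in> trapezoid a' b' c' d'"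
  obtain x y where xy: "p = (x, y)" by fastforce
  note t = trapezoid_bounds[OF p(1)[unfolded xy] assms(1,2)] trapezoid_bounds[OF p(2)[unfolded xy] assms(3,4)]
  \<comment> \<open>Strictness comes from the bottom line if \<open>y = 0\<close> and from the top
    line otherwise.\<close>
  have "b * y + d * (1 - y) < a' * y + c' * (1 - y)"
  proof (cases "y = 0")
    case False
    with t assms have "b * y < a' * y" "d * (1 - y) \<le> c' * (1 - y)"
      by (auto intro!: mult_right_mono)
    then show ?thesis by simp
  qed (use assms in simp)
  with t show False by simp
qed

text \<open>If no segments joining corners meet, then for every choice of a top and a bottom corner
  in each trapezoid the strict orders on the two lines agree. Fixing the bottom corners forces all
  top comparisons the same way, and conversely.\<close>

lemma trapezoids_disjoint_iff:
  assumes "a \<le> b" "c \<le> d" "a' \<le> b'" "c' \<le> d'"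
  shows "trapezoid a b c d \<inter> trapezoid a' b' c' d' = {} \<longleftrightarrow> b < a' \<and> d < c' \<or> b' < a \<and> d' < c"
proof
  assume disj: "trapezoid a b c d \<inter> trapezoid a' b' c' d' = {}"
  have no_crossing: "\<not> (p \<le> p' \<and> q' \<le> q)" "\<not> (p' \<le> p \<and> q \<le> q')"
    if "p \<in> {a, b}" "q \<in> {c, d}" "p' \<in> {a', b'}" "q' \<in> {c', d'}" for p q p' q'
    using trapezoids_meet_if_crossing[of p a b q c d p' a' b' q' c' d']
      trapezoids_meet_if_crossing[of p' a' b' q' c' d' p a b q c d] that disj by (auto simp: Int_commute)
  show "b < a' \<and> d < c' \<or> b' < a \<and> d' < c"
    using no_crossing[of a c b' c'] no_crossing[of b c a' c'] no_crossing[of a d b' c']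
      no_crossing[of b d a' c'] no_crossing[of a c b' d'] no_crossing[of b c a' d'] assms by simp argo
next
  assume "b < a' \<and> d < c' \<or> b' < a \<and> d' < c"
  then show "trapezoid a b c d \<inter> trapezoid a' b' c' d' = {}"
    using trapezoids_disjoint_if_separated[of a b c d a' b' c' d']
      trapezoids_disjoint_if_separated[of a' b' c' d' a b c d] assms by (auto simp: Int_commute)
qed

section \<open>Placing the endpoints on integer positions\<close>

text \<open>Sorting by induction: an element of maximal key takes the last position, so ties are
  broken arbitrarily.\<close>

lemma ranking_of_key:
  fixes f :: "'a \<Rightarrow> nat"
  assumes "finite X"
  shows "\<exists>pos. bij_betw pos X {1..card X} \<and> (\<forall>x\<in>X. \<forall>y\<in>X. f x < f y \<longrightarrow> pos x < pos y)"
  using assms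
proof (induction X rule: finite_psubset_induct)
  case (psubset X)
  show ?case
  proof (cases "X = {}")
    case False
    with psubset.hyps obtain m where m: "m \<in> X" "\<And>x. x \<in> X \<Longrightarrow> f x \<le> f m"
      using Max_in[of "f ` X"] Max_ge[of "f ` X"] by (metis finite_imageI imageE imageI image_is_empty)
    define n where "n = card (X - {m})"
    have X: "X = insert m (X - {m})" "card X = Suc n"
      using m(1) psubset.hyps card.remove[of X m] by (auto simp: n_def)
    obtain pos where pos: "bij_betw pos (X - {m}) {1..n}"
      "\<forall>x\<in>X - {m}. \<forall>y\<in>X - {m}. f x < f y \<longrightarrow> pos x < pos y"
      using psubset.IH[of "X - {m}"] m(1) unfolding n_def by blast
    let ?pos = "pos(m := Suc n)"
    have "bij_betw ?pos (X - {m}) {1..n}"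
      using pos(1) by (subst bij_betw_cong[where g = pos]) auto
    then have "bij_betw ?pos (X - {m} \<union> {m}) ({1..n} \<union> {Suc n})"
      by (rule bij_betw_combine) (auto simp: bij_betw_def)
    moreover have "X - {m} \<union> {m} = X" "{1..n} \<union> {Suc n} = {1..card X}" using X by auto
    ultimately have "bij_betw ?pos X {1..card X}" by metis
    moreover have "pos x < Suc n" if "x \<in> X - {m}" for x
      using bij_betwE[OF pos(1)] that by (metis atLeastAtMost_iff le_imp_less_Suc)
    then have "?pos x < ?pos y" if "x \<in> X" "y \<in> X" "f x < f y" for x y
      using pos(2) that m(2)[of y] by (auto simp: not_le[symmetric])
    ultimately show ?thesis by blast
  qed (auto simp: bij_betw_def)
qed

text \<open>Naming an endpoint by its node and side lets one bijection on
  \<open>V \<times> UNIV\<close> express that each position of a line is used exactly once.\<close>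

definition endpoint :: "('v \<Rightarrow> 'a) \<Rightarrow> ('v \<Rightarrow> 'a) \<Rightarrow> 'v \<times> bool \<Rightarrow> 'a" where
  "endpoint l r = (\<lambda>(v, right). if right then r v else l v)"

lemma endpoint_simps [simp]: "endpoint l r (v, True) = r v" "endpoint l r (v, False) = l v"
  by (simp_all add: endpoint_def)

definition placement :: "nat set \<Rightarrow> (nat \<Rightarrow> nat) \<Rightarrow> (nat \<Rightarrow> nat) \<Rightarrow> bool" where
  "placement V l r \<longleftrightarrow> (\<forall>v\<in>V. l v < r v) \<and> bij_betw (endpoint l r) (V \<times> UNIV) {1..2 * card V}"

text \<open>This is the perturbation. Whether intervals meet depends only on comparing right ends
  with left ends, so sorting by \<open>key\<close> suffices: it counts the strictly smaller
  coordinates, doubled to leave room for a tie-breaking bit.\<close>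

lemma placement_of_intervals:
  fixes a b :: "nat \<Rightarrow> real"
  assumes "finite V" "\<And>v. v \<in> V \<Longrightarrow> a v \<le> b v"
  shows "\<exists>l r. placement V l r \<and> (\<forall>u\<in>V. \<forall>v\<in>V. r u < l v \<longleftrightarrow> b u < a v)"
proof -
  let ?X = "V \<times> (UNIV :: bool set)" and ?f = "endpoint a b"
  let ?below = "\<lambda>x. {e \<in> ?X. ?f e < x}"
  \<comment> \<open>Touching trapezoids intersect, so among equal coordinates left endpoints come first.\<close>
  define key where "key e = 2 * card (?below (?f e)) + (if snd e then 1 else 0 :: nat)" for e
  have fin: "finite ?X" using assms(1) by simp
  have rank_less: "card (?below (?f e)) < card (?below (?f e'))" if "e \<in> ?X" "?f e < ?f e'" for e e'
    using that fin by (intro psubset_card_mono psubsetI) (auto 0 3 simp del: mem_Sigma_iff)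
  have key_less: "key e < key e'" if "e \<in> ?X" "?f e < ?f e' \<or> ?f e = ?f e' \<and> \<not> snd e \<and> snd e'" for e e'
    using that rank_less[of e e'] by (fastforce simp: key_def)
  obtain pos where pos: "bij_betw pos ?X {1..card ?X}" "\<forall>x\<in>?X. \<forall>y\<in>?X. key x < key y \<longrightarrow> pos x < pos y"
    using ranking_of_key[OF fin] by blast
  let ?l = "\<lambda>v. pos (v, False)" and ?r = "\<lambda>v. pos (v, True)"
  have "endpoint ?l ?r = pos" by (auto simp: endpoint_def fun_eq_iff)
  then have bij: "bij_betw (endpoint ?l ?r) ?X {1..2 * card V}"
    using pos(1) by (simp add: card_cartesian_product mult.commute)
  have lr: "?l v < ?r u" if "u \<in> V" "v \<in> V" "a v \<le> b u" for u v
    using that pos(2) key_less[of "(v, False)" "(u, True)"] by (auto simp: less_le)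
  have rl: "?r u < ?l v" if "u \<in> V" "v \<in> V" "b u < a v" for u v
    using that pos(2) key_less[of "(u, True)" "(v, False)"] by auto
  have "placement V ?l ?r" using bij lr assms(2) by (auto simp: placement_def)
  moreover have "?r u < ?l v \<longleftrightarrow> b u < a v" if "u \<in> V" "v \<in> V" for u v
    using lr[OF that] rl[OF that] by fastforce
  ultimately show ?thesis by (intro exI[of _ ?l] exI[of _ ?r]) simp
qed

definition left_of :: "(nat \<Rightarrow> 'a::ord) \<Rightarrow> (nat \<Rightarrow> 'a) \<Rightarrow> (nat \<Rightarrow> 'a) \<Rightarrow> (nat \<Rightarrow> 'a) \<Rightarrow> nat \<Rightarrow> nat \<Rightarrow> bool" where
  "left_of a b c d u v \<longleftrightarrow> b u < a v \<and> d u < c v"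

definition models :: "nat set \<Rightarrow> (nat \<Rightarrow> nat \<Rightarrow> bool) \<Rightarrow> (nat \<Rightarrow> 'a::ord) \<Rightarrow> (nat \<Rightarrow> 'a) \<Rightarrow> (nat \<Rightarrow> 'a) \<Rightarrow> (nat \<Rightarrow> 'a) \<Rightarrow> bool" where
  "models V E a b c d \<longleftrightarrow>
     (\<forall>u\<in>V. \<forall>v\<in>V. u \<noteq> v \<longrightarrow> (E u v \<longleftrightarrow> \<not> left_of a b c d u v \<and> \<not> left_of a b c d v u))"

lemma models_swap: "models V E a b c d \<Longrightarrow> models V E c d a b"
  unfolding models_def left_of_def by blast

text \<open>This replaces the geometry by integer positions; for the converse, the positions
  themselves serve as corners.\<close>

lemma trapezoid_graph_iff_placement:
  assumes "finite V"
  shows "trapezoid_graph V E \<longleftrightarrow>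
    (\<exists>a b c d. placement V a b \<and> placement V c d \<and> models V E a b c d)"
proof
  assume "trapezoid_graph V E"
  then obtain a b c d :: "nat \<Rightarrow> real" where rep: "\<forall>u\<in>V. \<forall>v\<in>V. u \<noteq> v \<longrightarrow>
      (E u v \<longleftrightarrow> trapezoid (a u) (b u) (c u) (d u) \<inter> trapezoid (a v) (b v) (c v) (d v) \<noteq> {})"
    unfolding trapezoid_graph_def by blast
  \<comment> \<open>The corners on a line may come in either order; sorting them leaves the hull
    unchanged.\<close>
  define a' where "a' v = min (a v) (b v)" for v
  define b' where "b' v = max (a v) (b v)" for v
  define c' where "c' v = min (c v) (d v)" for v
  define d' where "d' v = max (c v) (d v)" for v
  have le: "a' v \<le> b' v" "c' v \<le> d' v" for v
    by (auto simp: a'_def b'_def c'_def d'_def)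
  have trap: "trapezoid (a v) (b v) (c v) (d v) = trapezoid (a' v) (b' v) (c' v) (d' v)" for v
    unfolding a'_def b'_def c'_def d'_def by (rule trapezoid_sort)
  obtain l r where lr: "placement V l r" "\<forall>u\<in>V. \<forall>v\<in>V. r u < l v \<longleftrightarrow> b' u < a' v"
    using placement_of_intervals[OF assms, of a' b'] le by blast
  obtain l' r' where lr': "placement V l' r'" "\<forall>u\<in>V. \<forall>v\<in>V. r' u < l' v \<longleftrightarrow> d' u < c' v"
    using placement_of_intervals[OF assms, of c' d'] le by blast
  have "models V E l r l' r'"
    using rep lr(2) lr'(2) trapezoids_disjoint_iff[OF le le]
    unfolding models_def left_of_def trap by simp
  with lr(1) lr'(1) show "\<exists>a b c d. placement V a b \<and> placement V c d \<and> models V E a b c d" by blast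
next
  assume "\<exists>a b c d. placement V a b \<and> placement V c d \<and> models V E a b c d"
  then obtain a b c d where p: "placement V a b" "placement V c d" and m: "models V E a b c d" by blast
  have le: "a v \<le> b v" "c v \<le> d v" if "v \<in> V" for v
    using p that by (auto simp: placement_def less_imp_le)
  have "E u v \<longleftrightarrow> trapezoid (a u) (b u) (c u) (d u) \<inter> trapezoid (a v) (b v) (c v) (d v) \<noteq> {}"
    if "u \<in> V" "v \<in> V" "u \<noteq> v" for u v
  proof -
    have "E u v \<longleftrightarrow> \<not> (b u < a v \<and> d u < c v \<or> b v < a u \<and> d v < c u)"
      using m that unfolding models_def left_of_def by blast
    moreover have "trapezoid (a u) (b u) (c u) (d u) \<inter> trapezoid (a v) (b v) (c v) (d v) = {} \<longleftrightarrow>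
        b u < a v \<and> d u < c v \<or> b v < a u \<and> d v < c u"
      using le that by (subst trapezoids_disjoint_iff) auto
    ultimately show ?thesis by blast
  qed
  then show "trapezoid_graph V E"
    unfolding trapezoid_graph_def by (intro exI[of _ "\<lambda>v. real (a v)"] exI[of _ "\<lambda>v. real (b v)"]
      exI[of _ "\<lambda>v. real (c v)"] exI[of _ "\<lambda>v. real (d v)"] ballI impI)
qed

section \<open>Aggregation and the two lines in a connected network\<close>

locale network =
  fixes V :: "nat set" and E :: "nat \<Rightarrow> nat \<Rightarrow> bool"
  assumes simple_connected: "simple_connected_graph V E"
begin

lemma finite_V: "finite V" and V_nonempty: "V \<noteq> {}"
  and E_in_V: "E u v \<Longrightarrow> u \<in> V" "E u v \<Longrightarrow> v \<in> V"
  and E_sym: "E u v \<Longrightarrow> E v u" and E_irrefl: "\<not> E v v"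
  and E_connected: "u \<in> V \<Longrightarrow> v \<in> V \<Longrightarrow> E\<^sup>*\<^sup>* u v"
  using simple_connected unfolding simple_connected_graph_def by blast+

definition closed_nbrs :: "nat \<Rightarrow> nat set" where
  "closed_nbrs v = insert v {w. E v w}"

lemma finite_nbrs: "finite {w. E v w}"
  by (rule finite_subset[OF _ finite_V]) (auto dest: E_in_V)

section \<open>Connectivity and sums along a spanning tree\<close>

lemma constant_if_locally_constant:
  assumes "\<And>u v. E u v \<Longrightarrow> f u = f v" "u \<in> V" "v \<in> V"
  shows "f u = f v"
proof -
  have "E\<^sup>*\<^sup>* u v" using E_connected assms by blast
  then show ?thesis by induction (use assms(1) in auto)
qed

lemma edge_leaving:
  assumes "s \<in> S" "t \<in> V" "S \<subseteq> V" "t \<notin> S"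
  obtains x y where "x \<in> S" "y \<in> V - S" "E x y"
proof -
  have "\<not> (\<forall>u v. E u v \<longrightarrow> (u \<in> S) = (v \<in> S))"
    using constant_if_locally_constant[of "\<lambda>x. x \<in> S" s t] assms by blast
  then show ?thesis using that E_sym E_in_V by blast
qed

text \<open>\<open>e\<close> is the distance to \<open>r\<close>; the first step of a shortest walk
  lowers it.\<close>

lemma descent_to_root:
  assumes "r \<in> V"
  shows "\<exists>e :: nat \<Rightarrow> nat. \<forall>v\<in>V - {r}. \<exists>w. E v w \<and> e w < e v"
proof -
  define e where "e v = (LEAST k. (E ^^ k) v r)" for v
  have "\<exists>w. E v w \<and> e w < e v" if "v \<in> V - {r}" for v
  proof -
    have "\<exists>k. (E ^^ k) v r" using E_connected assms that by (simp add: rtranclp_power)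
    then have "(E ^^ e v) v r" unfolding e_def by (rule LeastI_ex)
    moreover from this have "e v \<noteq> 0" using that by (cases "e v") auto
    ultimately obtain k where k: "e v = Suc k" "(E ^^ Suc k) v r" by (metis not0_implies_Suc)
    obtain w where w: "E v w" "(E ^^ k) w r" using relpowp_Suc_D2[OF k(2)] by blast
    have "e w \<le> k" unfolding e_def by (rule Least_le) (rule w(2))
    with w(1) k(1) show ?thesis by auto
  qed
  then show ?thesis by blast
qed

text \<open>The tree is fixed before \<open>f\<close>, so one set of parent pointers serves several
  sums. The bound on \<open>s v\<close> keeps certificate entries small.\<close>

lemma aggregation_exists:
  assumes "r \<in> V"
  shows "\<exists>parent. (\<forall>v\<in>V - {r}. E v (parent v)) \<and>
    (\<forall>f :: nat \<Rightarrow> nat. \<exists>s. s r = sum f V \<and>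
      (\<forall>v\<in>V. s v \<le> sum f V \<and> s v = f v + sum s {w. E v w \<and> w \<noteq> r \<and> parent w = v}))"
proof -
  obtain e :: "nat \<Rightarrow> nat" where "\<forall>v\<in>V - {r}. \<exists>w. E v w \<and> e w < e v"
    using descent_to_root[OF assms] by blast
  then obtain parent where parent: "\<And>v. v \<in> V - {r} \<Longrightarrow> E v (parent v) \<and> e (parent v) < e v"
    by metis
  define R where "R = {(v, parent v) | v. v \<in> V - {r}}"
  \<comment> \<open>The aggregate of \<open>v\<close> is the sum of \<open>f\<close> over the subtree \<open>desc v\<close>.\<close>
  define desc where "desc v = {w \<in> V. (w, v) \<in> R\<^sup>*}" for v
  have e_mono: "e v \<le> e w" if "(w, v) \<in> R\<^sup>*" for v w
    using that
  proof induction
    case (step y z)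
    with parent[of y] show ?case by (auto simp: R_def)
  qed simp
  \<comment> \<open>Parents are unique, so the ancestors of a node form a chain. Siblings with a
    common descendant would thus be comparable, which \<open>siblings\<close> refutes because
    \<open>e\<close> drops towards the root; hence their subtrees are disjoint.\<close>
  have confl: "(x, y) \<in> R\<^sup>* \<or> (y, x) \<in> R\<^sup>*" if "(w, x) \<in> R\<^sup>*" "(w, y) \<in> R\<^sup>*" for w x y
    using that by (rule single_valued_confluent[rotated]) (auto simp: R_def single_valued_def)
  let ?ch = "\<lambda>v. {w. E v w \<and> w \<noteq> r \<and> parent w = v}"
  have ch: "?ch v = {w. (w, v) \<in> R}" for v
    using parent E_sym E_in_V by (auto simp: R_def)
  have siblings: False if "(x, y) \<in> R\<^sup>*" "x \<noteq> y" "(x, v) \<in> R" "(y, v) \<in> R" for x y v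
  proof -
    from that(1,2) obtain z where "(x, z) \<in> R" "(z, y) \<in> R\<^sup>*" by (metis converse_rtranclE)
    with that(3) have "(v, y) \<in> R\<^sup>*" by (auto simp: R_def)
    with e_mono that(4) parent show False by (fastforce simp: R_def)
  qed
  have desc: "desc v = insert v (\<Union>w\<in>?ch v. desc w)" if "v \<in> V" for v
    unfolding ch desc_def using that by (auto elim: rtranclE intro: rtrancl_into_rtrancl)
  have "(v, w) \<notin> R\<^sup>*" if "(w, v) \<in> R" for v w
    using that e_mono[of v w] parent[of w] by (auto simp: R_def)
  then have v_notin: "v \<notin> (\<Union>w\<in>?ch v. desc w)" for v
    unfolding ch desc_def by blast
  have disj: "desc x \<inter> desc y = {}" if "x \<in> ?ch v" "y \<in> ?ch v" "x \<noteq> y" for x y v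
    using that confl siblings[of x y v] siblings[of y x v] unfolding ch desc_def by blast
  have fin: "finite (desc v)" for v using finite_V by (simp add: desc_def)
  have fin_ch: "finite (?ch v)" for v by (rule finite_subset[OF _ finite_nbrs[of v]]) auto
  have desc_r: "desc r = V"
  proof -
    have "(v, r) \<in> R\<^sup>*" if "v \<in> V" for v
      using that
    proof (induction "e v" arbitrary: v rule: less_induct)
      case less
      show ?case
      proof (cases "v = r")
        case False
        with less.prems parent[of v] E_in_V less.hyps[of "parent v"]
        have "(parent v, r) \<in> R\<^sup>*" "(v, parent v) \<in> R" by (auto simp: R_def)
        then show ?thesis by (rule converse_rtrancl_into_rtrancl[rotated])
      qed simp
    qed
    then show ?thesis by (auto simp: desc_def)
  qed
  have sum_desc: "sum f (desc v) = f v + (\<Sum>w\<in>?ch v. sum f (desc w))" if "v \<in> V" for f :: "nat \<Rightarrow> nat" and v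
  proof -
    have "sum f (desc v) = f v + sum f (\<Union>w\<in>?ch v. desc w)"
      unfolding desc[OF that] using v_notin fin fin_ch by (subst sum.insert) auto
    also have "sum f (\<Union>w\<in>?ch v. desc w) = (\<Sum>w\<in>?ch v. sum f (desc w))"
      using fin fin_ch disj by (intro sum.UNION_disjoint) auto
    finally show ?thesis .
  qed
  have sum_le: "sum f (desc v) \<le> sum f V" for f :: "nat \<Rightarrow> nat" and v
    using finite_V by (intro sum_mono2) (auto simp: desc_def)
  have "\<exists>s. s r = sum f V \<and> (\<forall>v\<in>V. s v \<le> sum f V \<and> s v = f v + sum s (?ch v))" for f :: "nat \<Rightarrow> nat"
    by (intro exI[of _ "\<lambda>v. sum f (desc v)"] conjI ballI sum_le sum_desc) (simp_all add: desc_r)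
  with parent show ?thesis by blast
qed

text \<open>Summing the local equations cancels every aggregate but that of the root; in particular
  the parent pointers need not be checked for acyclicity.\<close>

lemma aggregation_sound:
  fixes f s :: "nat \<Rightarrow> nat"
  assumes parent: "\<And>v. v \<in> V \<Longrightarrow> v \<notin> R \<Longrightarrow> E v (parent v)"
    and agg: "\<And>v. v \<in> V \<Longrightarrow> s v = f v + sum s {w. E v w \<and> w \<notin> R \<and> parent w = v}"
  shows "sum s (V \<inter> R) = sum f V"
proof -
  have "sum s V = sum f V + (\<Sum>v\<in>V. sum s {w. E v w \<and> w \<notin> R \<and> parent w = v})"
    using agg by (simp add: sum.distrib[symmetric])
  \<comment> \<open>Regrouping by parent: each node outside \<open>R\<close> is a child of exactly
    one node of \<open>V\<close>.\<close>
  also have "(\<Sum>v\<in>V. sum s {w. E v w \<and> w \<notin> R \<and> parent w = v}) = (\<Sum>v\<in>V. sum s {w \<in> V - R. parent w = v})"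
    using parent E_sym E_in_V by (intro sum.cong refl arg_cong2[where f = sum]) blast
  also have "\<dots> = sum s (V - R)"
    using finite_V parent E_in_V by (intro sum.group) (auto, blast)
  also have "sum s V = sum s (V \<inter> R) + sum s (V - R)"
    using finite_V by (subst sum.union_disjoint[symmetric]) (auto intro: sum.cong simp: Int_Diff_Un)
  finally show ?thesis by simp
qed

section \<open>Certifying that no position on a line is missing\<close>

definition spots :: "(nat \<Rightarrow> nat) \<Rightarrow> (nat \<Rightarrow> nat) \<Rightarrow> nat \<Rightarrow> nat \<Rightarrow> bool" where
  "spots l r v q \<longleftrightarrow> (\<exists>w\<in>closed_nbrs v. q = l w \<or> q = r w)"

text \<open>The witness intervals by which neighbours convince each other that no position is skipped:
  node \<open>v\<close> vouches for all positions from \<open>lo v\<close> to \<open>hi v\<close>, where beyond \<open>r v\<close> it may rely on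
  what a neighbour \<open>t\<close> sees directly between \<open>lo t\<close> and \<open>r t\<close>.\<close>

definition line_ok :: "nat \<Rightarrow> (nat \<Rightarrow> nat) \<Rightarrow> (nat \<Rightarrow> nat) \<Rightarrow> (nat \<Rightarrow> nat) \<Rightarrow> (nat \<Rightarrow> nat) \<Rightarrow> nat \<Rightarrow> bool" where
  "line_ok m l r lo hi v \<longleftrightarrow>
     l v < r v \<and> lo v \<le> l v \<and>
     (\<forall>q\<in>{lo v..r v}. spots l r v q) \<and>
     (\<forall>q\<in>{l v..hi v}. spots l r v q \<or> (\<exists>t. E v t \<and> q \<in> {lo t..r t})) \<and>
     (r v = m \<or> (\<exists>z\<in>closed_nbrs v. l z \<le> r v \<and> r v < hi z))"

text \<open>From position 1 on, every occupied position below \<open>2 * card V\<close> has an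
  occupied successor: after a left end the node itself sees it; after a right end the witness
  \<open>z\<close> sees it or relies on what a neighbour \<open>t\<close> sees.\<close>

lemma placement_if_line_ok:
  assumes ok: "\<And>v. v \<in> V \<Longrightarrow> line_ok (2 * card V) l r lo hi v"
    and "v0 \<in> V" "l v0 = 1"
  shows "placement V l r"
proof -
  let ?H = "endpoint l r ` (V \<times> UNIV)"
  have mem: "q \<in> ?H" if "w \<in> V" "q = l w \<or> q = r w" for q w
    using that by (force simp: endpoint_def image_iff)
  have closed: "w \<in> V" if "w \<in> closed_nbrs v" "v \<in> V" for v w
    using that E_in_V by (auto simp: closed_nbrs_def)
  have spots: "q \<in> ?H" if "spots l r v q" "v \<in> V" for v q
    using that mem closed unfolding spots_def by blast
  have step: "Suc q \<in> ?H" if q: "q \<in> ?H" "q < 2 * card V" for q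
  proof -
    obtain v where v: "v \<in> V" "q = l v \<or> q = r v"
      using q(1) by (auto simp: endpoint_def split: if_splits)
    show ?thesis
    proof (cases "q = l v")
      case True
      with v ok[of v] have "spots l r v (Suc q)" by (auto simp: line_ok_def)
      with v spots show ?thesis by blast
    next
      case False
      with v q(2) ok[of v] obtain z where z: "z \<in> closed_nbrs v" "l z \<le> q" "q < hi z"
        by (auto simp: line_ok_def)
      with closed v have "z \<in> V" by blast
      with ok[of z] z have "spots l r z (Suc q) \<or> (\<exists>t. E z t \<and> Suc q \<in> {lo t..r t})"
        by (auto simp: line_ok_def)
      then show ?thesis
      proof (elim disjE exE conjE)
        fix t assume t: "E z t" "Suc q \<in> {lo t..r t}"
        then have "spots l r t (Suc q)" using ok[of t] E_in_V by (auto simp: line_ok_def)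
        with spots t E_in_V show ?thesis by blast
      qed (use spots \<open>z \<in> V\<close> in blast)
    qed
  qed
  have "q \<in> ?H" if "1 \<le> q" "q \<le> 2 * card V" for q
    using that
  proof (induction q rule: nat_induct_at_least)
    case base
    then show ?case using mem assms(2,3) by metis
  qed (use step in auto)
  then have sub: "{1..2 * card V} \<subseteq> ?H" by auto
  have card: "card (V \<times> (UNIV :: bool set)) = 2 * card V" by (simp add: card_cartesian_product)
  have fin: "finite (V \<times> (UNIV :: bool set))" using finite_V by simp
  \<comment> \<open>As many endpoints as positions: covering all positions forces equality and
    injectivity.\<close>
  have H: "{1..2 * card V} = ?H"
    using card_image_le[OF fin, of "endpoint l r"] card fin sub by (intro card_seteq) auto
  then have "card ?H = card (V \<times> (UNIV :: bool set))" unfolding H[symmetric] card by simp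
  then have "inj_on (endpoint l r) (V \<times> UNIV)" by (rule eq_card_imp_inj_on[OF fin])
  with H ok show ?thesis by (auto simp: placement_def bij_betw_def line_ok_def)
qed

text \<open>\<open>lo v\<close> and \<open>hi v\<close> are chosen extremal, so membership in
  \<open>lo_set\<close> or \<open>hi_set\<close> bounds them. The hard condition is the last one in
  \<open>line_ok\<close>, proved as \<open>next_pos\<close>.\<close>

lemma line_ok_if_models:
  assumes place: "placement V a b" and cd: "\<And>v. v \<in> V \<Longrightarrow> c v < d v" and models: "models V E a b c d"
  shows "\<exists>lo hi. \<forall>v\<in>V. lo v \<le> 2 * card V \<and> hi v \<le> 2 * card V \<and> line_ok (2 * card V) a b lo hi v"
proof -
  let ?m = "2 * card V"
  have ab: "a v < b v" if "v \<in> V" for v using place that by (auto simp: placement_def)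
  have img: "endpoint a b ` (V \<times> UNIV) = {1..?m}" using place by (auto simp: placement_def bij_betw_def)
  have b_le: "b v \<le> ?m" if "v \<in> V" for v
  proof -
    have "endpoint a b (v, True) \<in> {1..?m}" unfolding img[symmetric] using that by blast
    then show ?thesis by simp
  qed
  have holder: "\<exists>x\<in>V. q = a x \<or> q = b x" if "1 \<le> q" "q \<le> ?m" for q
  proof -
    have "q \<in> endpoint a b ` (V \<times> UNIV)" unfolding img using that by simp
    then show ?thesis by (auto simp: endpoint_def split: if_splits)
  qed
  have a_ge: "1 \<le> a v" if "v \<in> V" for v
  proof -
    have "endpoint a b (v, False) \<in> {1..?m}" unfolding img[symmetric] using that by blast
    then show ?thesis by simp
  qed
  have nbr: "u \<in> closed_nbrs v"
    if "u \<in> V" "v \<in> V" "\<not> (b u < a v \<and> d u < c v)" "\<not> (b v < a u \<and> d v < c u)" for u v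
    using that models by (auto simp: closed_nbrs_def models_def left_of_def)
  define lo_set where "lo_set v = {p. 1 \<le> p \<and> p \<le> a v \<and> (\<forall>q\<in>{p..b v}. spots a b v q)}" for v
  define lo where "lo v = (LEAST p. p \<in> lo_set v)" for v
  define hi_set where "hi_set v = {p. p \<le> ?m \<and>
      (\<forall>q\<in>{a v..p}. spots a b v q \<or> (\<exists>t. E v t \<and> q \<in> {lo t..b t}))}" for v
  define hi where "hi v = Max (hi_set v)" for v
  \<comment> \<open>A node with an end inside the interval of \<open>v\<close> overlaps it on this
    line, so it is not separated from \<open>v\<close>.\<close>
  have inside: "spots a b v q" if q: "v \<in> V" "q \<in> {a v..b v}" for v q
  proof -
    obtain x where x: "x \<in> V" "q = a x \<or> q = b x"
      using holder[of q] q a_ge[of v] b_le[of v] by fastforce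
    then have "x \<in> closed_nbrs v" using q ab[of x] by (intro nbr) auto
    then show ?thesis using x by (auto simp: spots_def)
  qed
  have lo_in: "lo v \<in> lo_set v" if "v \<in> V" for v
    unfolding lo_def by (rule LeastI[of _ "a v"]) (use that inside a_ge in \<open>auto simp: lo_set_def\<close>)
  have lo_le: "lo v \<le> p" if "p \<in> lo_set v" for v p
    unfolding lo_def using that by (rule Least_le)
  have fin_hi: "finite (hi_set v)" for v
    by (rule finite_subset[of _ "{..?m}"]) (auto simp: hi_set_def)
  have b_in_hi: "b v \<in> hi_set v" if "v \<in> V" for v
    using that inside b_le by (auto simp: hi_set_def)
  have hi_in: "hi v \<in> hi_set v" if "v \<in> V" for v
    unfolding hi_def using fin_hi b_in_hi[OF that] by (intro Max_in) auto
  have hi_ge: "p \<le> hi v" if "p \<in> hi_set v" for v p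
    unfolding hi_def using fin_hi that by simp
  have next_pos: "\<exists>z\<in>closed_nbrs v. a z \<le> b v \<and> b v < hi z" if v: "v \<in> V" and not_last: "b v \<noteq> ?m" for v
  proof (cases "\<exists>z\<in>V. a z \<le> b v \<and> b v < b z")
    case True
    then obtain z where z: "z \<in> V" "a z \<le> b v" "b v < b z" by blast
    then have "z \<in> closed_nbrs v" using v ab[of v] by (intro nbr) auto
    moreover have "b z \<le> hi z" using hi_ge b_in_hi z by blast
    ultimately show ?thesis using z by force
  next
    case False
    \<comment> \<open>No trapezoid covers the gap after position \<open>b v\<close> on this line. By connectedness, the
      trapezoid before the gap reaching furthest right on the other line meets the one after the
      gap reaching furthest left.\<close>
    define S where "S = {x \<in> V. b x \<le> b v}"
    define T where "T = {x \<in> V. b v < a x}"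
    have ST: "V - S = T" "S \<subseteq> V" "T \<subseteq> V" using False ab by (fastforce simp: S_def T_def)+
    have fin: "finite S" "finite T" using finite_V ST finite_subset by auto
    have vS: "v \<in> S" using v by (simp add: S_def)
    obtain w where "w \<in> V" "Suc (b v) = a w \<or> Suc (b v) = b w"
      using holder[of "Suc (b v)"] b_le[OF v] not_last by auto
    then have wT: "w \<in> T" using False ab[of w] by (auto simp: T_def)
    obtain s where s: "s \<in> S" "\<And>x. x \<in> S \<Longrightarrow> d x \<le> d s"
      using fin vS Max_in[of "d ` S"] Max_ge[of "d ` S"] by (metis empty_iff finite_imageI imageE imageI image_is_empty)
    obtain t where t: "t \<in> T" "\<And>x. x \<in> T \<Longrightarrow> c t \<le> c x"
      using fin wT Min_in[of "c ` T"] Min_le[of "c ` T"] by (metis empty_iff finite_imageI imageE imageI image_is_empty)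
    \<comment> \<open>An edge across the gap is separated on this line, so its trapezoids meet on
      the other one: \<open>c y \<le> d x\<close>. The extremal choices then give
      \<open>c t \<le> c y \<le> d x \<le> d s\<close>.\<close>
    obtain x y where xy: "x \<in> S" "y \<in> T" "E x y"
      using edge_leaving[OF vS, of w] wT ST by blast
    have "b x < a y" "x \<noteq> y" "x \<in> V" "y \<in> V" using xy E_irrefl by (auto simp: S_def T_def)
    then have "c y \<le> d x" using xy(3) models by (simp add: models_def left_of_def)
    then have "c t \<le> d s" using s t xy by (meson order_trans)
    then have "t \<in> closed_nbrs s"
      using s t ST ab[of t] ab[of s] by (intro nbr) (auto simp: S_def T_def)
    then have st: "E s t" using s t ab[of t] by (auto simp: closed_nbrs_def S_def T_def)
    \<comment> \<open>On the other line no node of \<open>S\<close> lies wholly after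
      \<open>s\<close> and none of \<open>T\<close> wholly before \<open>t\<close>. So
      \<open>s\<close> sees all positions from \<open>a s\<close> up to the gap, and
      \<open>t\<close> all positions from the gap to \<open>b t\<close>.\<close>
    have d_s: "c x \<le> d s" if "x \<in> S" for x using s(2)[OF that] cd[of x] that ST by force
    have c_t: "c t \<le> d x" if "x \<in> T" for x using t(2)[OF that] cd[of x] that ST by force
    have sv: "s \<in> closed_nbrs v"
      using s v vS d_s[OF vS] ab[of s] by (intro nbr) (auto simp: S_def)
    have "Suc (b v) \<in> lo_set t"
      unfolding lo_set_def
    proof (intro CollectI conjI ballI)
      fix q assume q: "q \<in> {Suc (b v)..b t}"
      obtain x where x: "x \<in> V" "q = a x \<or> q = b x"
        using holder[of q] q b_le[of t] t ST by fastforce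
      then have xT: "x \<in> T" using ST q ab[of x] by (auto simp: S_def)
      then have "x \<in> closed_nbrs t"
        using x q t ST c_t[OF xT] ab[of x] by (intro nbr) auto
      with x show "spots a b t q" by (auto simp: spots_def)
    qed (use t in \<open>auto simp: T_def\<close>)
    then have lo_t: "lo t \<le> Suc (b v)" by (rule lo_le)
    \<comment> \<open>Up to \<open>b v\<close> node \<open>s\<close> sees the positions itself; the
      one position past the gap is vouched for by \<open>t\<close>. Thus \<open>s\<close> is the
      required witness for \<open>v\<close>.\<close>
    have "Suc (b v) \<in> hi_set s"
      unfolding hi_set_def
    proof (intro CollectI conjI ballI)
      fix q assume q: "q \<in> {a s..Suc (b v)}"
      show "spots a b s q \<or> (\<exists>t. E s t \<and> q \<in> {lo t..b t})"
      proof (cases "q = Suc (b v)")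
        case True
        then show ?thesis using st lo_t t ab[of t] by (auto simp: T_def)
      next
        case False
        obtain x where x: "x \<in> V" "q = a x \<or> q = b x"
          using holder[of q] q a_ge[of s] s ST b_le[OF v] False by fastforce
        then have "x \<notin> T" using q False ab[of x] by (auto simp: T_def)
        then have xS: "x \<in> S" using ST x by blast
        have "x \<in> closed_nbrs s"
          using x q s ST d_s[OF xS] ab[of x] by (intro nbr) auto
        with x show ?thesis by (auto simp: spots_def)
      qed
    qed (use not_last b_le[OF v] in auto)
    then have "b v < hi s" using hi_ge by fastforce
    moreover have "a s \<le> b v" using s ab[of s] by (auto simp: S_def)
    ultimately show ?thesis using sv by blast
  qed
  have "lo v \<le> ?m \<and> hi v \<le> ?m \<and> line_ok ?m a b lo hi v" if "v \<in> V" for v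
    using lo_in[OF that] hi_in[OF that] next_pos[OF that] ab[OF that] b_le[OF that]
    by (auto simp: lo_set_def hi_set_def line_ok_def)
  then show ?thesis by blast
qed

section \<open>Counting the endpoints to the left of a node\<close>

definition nbr_ends_before :: "(nat \<Rightarrow> nat) \<Rightarrow> (nat \<Rightarrow> nat) \<Rightarrow> nat \<Rightarrow> nat" where
  "nbr_ends_before l r v = card {w. E v w \<and> l w < l v} + card {w. E v w \<and> r w < l v}"

text \<open>The \<open>l v - 1\<close> positions before \<open>l v\<close> all hold endpoints. A
  nonneighbour lies entirely to one side of \<open>v\<close>, so it contributes two of them or
  none.\<close>

lemma left_end_count:
  assumes place: "placement V l r" and v: "v \<in> V"
    and disj: "\<And>w. w \<in> V - closed_nbrs v \<Longrightarrow> r w < l v \<or> r v < l w"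
  shows "l v = 1 + nbr_ends_before l r v + 2 * card {w \<in> V - closed_nbrs v. r w < l v}"
proof -
  let ?X = "{e \<in> V \<times> UNIV. endpoint l r e < l v}" and ?M = "{w \<in> V - closed_nbrs v. r w < l v}"
  have bij: "bij_betw (endpoint l r) (V \<times> UNIV) {1..2 * card V}" and lr: "\<And>w. w \<in> V \<Longrightarrow> l w < r w"
    using place by (auto simp: placement_def)
  have img: "endpoint l r ` (V \<times> UNIV) = {1..2 * card V}" using bij by (simp add: bij_betw_def)
  have "endpoint l r (v, False) \<in> {1..2 * card V}" unfolding img[symmetric] using v by blast
  then have lv: "1 \<le> l v" "l v \<le> 2 * card V" by auto
  have "endpoint l r ` ?X = {1..<l v}"
  proof
    show "endpoint l r ` ?X \<subseteq> {1..<l v}" using img by force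
    show "{1..<l v} \<subseteq> endpoint l r ` ?X"
    proof
      fix q assume q: "q \<in> {1..<l v}"
      then have "q \<in> endpoint l r ` (V \<times> UNIV)" unfolding img using lv by auto
      with q show "q \<in> endpoint l r ` ?X" by auto
    qed
  qed
  moreover have "inj_on (endpoint l r) ?X"
    using bij by (auto simp: bij_betw_def intro: inj_on_subset)
  ultimately have cX: "card ?X = l v - 1" using card_image by fastforce
  have left_iff: "l w < l v \<longleftrightarrow> r w < l v" if "w \<in> V" "\<not> E v w" for w
    using disj[of w] lr[of w] lr[OF v] that by (cases "w = v") (auto simp: closed_nbrs_def)
  have "?X = (\<lambda>w. (w, False)) ` {w \<in> V. l w < l v} \<union> (\<lambda>w. (w, True)) ` {w \<in> V. r w < l v}"
    by (auto simp: endpoint_def split: if_splits)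
  then have "card ?X = card {w \<in> V. l w < l v} + card {w \<in> V. r w < l v}"
    using finite_V by (simp, subst card_Un_disjoint) (auto simp: card_image inj_on_def)
  also have "{w \<in> V. l w < l v} = {w. E v w \<and> l w < l v} \<union> ?M"
    using E_in_V left_iff lr[OF v] by (auto simp: closed_nbrs_def)
  also have "card \<dots> = card {w. E v w \<and> l w < l v} + card ?M"
    using finite_V finite_nbrs by (intro card_Un_disjoint) (auto simp: closed_nbrs_def)
  also have "{w \<in> V. r w < l v} = {w. E v w \<and> r w < l v} \<union> ?M"
    using E_in_V left_iff lr[OF v] by (auto simp: closed_nbrs_def)
  also have "card \<dots> = card {w. E v w \<and> r w < l v} + card ?M"
    using finite_V finite_nbrs by (intro card_Un_disjoint) (auto simp: closed_nbrs_def)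
  finally show ?thesis using cX lv unfolding nbr_ends_before_def by simp
qed

text \<open>If the intervals overlapped, the left end of one node would lie within the other
  interval. The other node finds that position held in its closed neighbourhood, and by injectivity
  nobody but the first node holds it.\<close>

lemma nonnbrs_disjoint_if_line_ok:
  assumes place: "placement V l r" and ok: "\<And>v. v \<in> V \<Longrightarrow> line_ok m l r lo hi v"
    and uv: "u \<in> V" "v \<in> V" "u \<noteq> v" "\<not> E u v"
  shows "r u < l v \<or> r v < l u"
proof (rule ccontr)
  assume "\<not> ?thesis"
  have inj: "inj_on (endpoint l r) (V \<times> UNIV)" using place by (simp add: placement_def bij_betw_def)
  have same: "x = y" if "x \<in> V" "y \<in> V" "endpoint l r (x, i) = endpoint l r (y, j)" for x y i j
    using inj_onD[OF inj that(3)] that by auto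
  have no_end: False if xy: "x \<in> V" "y \<in> V" "x \<noteq> y" "\<not> E x y" and q: "l y \<in> {l x..r x}" for x y
  proof -
    have "spots l r x (l y)" using ok[OF xy(1)] q by (auto simp: line_ok_def)
    then obtain w i where w: "w \<in> closed_nbrs x" "endpoint l r (y, False) = endpoint l r (w, i)"
      unfolding spots_def by (metis endpoint_simps)
    then have "w \<in> V" using xy E_in_V by (auto simp: closed_nbrs_def)
    with same[OF xy(2) _ w(2)] w(1) xy show False by (auto simp: closed_nbrs_def)
  qed
  with \<open>\<not> ?thesis\<close> no_end[of u v] no_end[of v u] uv E_sym show False by fastforce
qed

text \<open>\<open>count\<close> says, without subtraction on naturals, that equally many
  nonneighbours precede \<open>v\<close> on both lines.\<close>

lemma models_if_counts_agree:
  assumes place: "placement V a b" "placement V c d"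
    and disj: "\<And>u v. u \<in> V \<Longrightarrow> v \<in> V \<Longrightarrow> u \<noteq> v \<Longrightarrow> \<not> E u v \<Longrightarrow> b u < a v \<or> b v < a u"
      "\<And>u v. u \<in> V \<Longrightarrow> v \<in> V \<Longrightarrow> u \<noteq> v \<Longrightarrow> \<not> E u v \<Longrightarrow> d u < c v \<or> d v < c u"
    and adj: "\<And>u v. E u v \<Longrightarrow> \<not> left_of a b c d u v"
    and count: "\<And>v. v \<in> V \<Longrightarrow> a v + nbr_ends_before c d v = c v + nbr_ends_before a b v"
  shows "models V E a b c d"
proof -
  define bad where "bad u v \<longleftrightarrow> u \<in> V \<and> v \<in> V \<and> u \<noteq> v \<and> \<not> E u v \<and>
      \<not> left_of a b c d u v \<and> \<not> left_of a b c d v u" for u v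
  have bad_sym: "bad u v \<Longrightarrow> bad v u" for u v using E_sym by (auto simp: bad_def)
  have ab: "a v < b v" if "v \<in> V" for v using place that by (auto simp: placement_def)
  have False if bad_ex: "\<exists>v u. bad v u"
  proof -
    obtain v where v: "\<exists>u. bad v u" "\<forall>x. (\<exists>u. bad x u) \<longrightarrow> a v \<le> a x"
      using ex_has_least_nat[of "\<lambda>v. \<exists>u. bad v u" _ a] bad_ex by blast
    then obtain u where bad: "bad v u" by blast
    have min: "a v \<le> a x" if "bad x y" for x y using v(2) that by blast
    have V: "u \<in> V" "v \<in> V" using bad by (auto simp: bad_def)
    let ?top = "{w \<in> V - closed_nbrs v. b w < a v}" and ?bot = "{w \<in> V - closed_nbrs v. d w < c v}"
    have non: "w \<in> V" "w \<noteq> v" "\<not> E v w" "\<not> E w v" if "w \<in> V - closed_nbrs v" for w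
      using that E_sym by (auto simp: closed_nbrs_def)
    have "a v = 1 + nbr_ends_before a b v + 2 * card ?top"
      using disj(1)[of _ v] non V by (intro left_end_count place) auto
    moreover have "c v = 1 + nbr_ends_before c d v + 2 * card ?bot"
      using disj(2)[of _ v] non V by (intro left_end_count place) auto
    ultimately have card_eq: "card ?top = card ?bot" using count[OF V(2)] by simp
    have "b v < a u"
      using disj(1)[of u v] bad min[OF bad_sym[OF bad]] ab[of u] E_sym by (auto simp: bad_def)
    then have u: "u \<in> ?bot" "u \<notin> ?top"
      using bad disj(2)[of u v] E_sym ab[of u] ab[of v] by (auto simp: bad_def left_of_def closed_nbrs_def)
    \<comment> \<open>By minimality of \<open>a v\<close>, a nonneighbour before \<open>v\<close> on
      top forms no bad pair with \<open>v\<close>, so it also precedes \<open>v\<close> on the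
      bottom. The bad partner \<open>u\<close> makes the inclusion strict.\<close>
    have "?top \<subseteq> ?bot"
    proof
      fix w assume w: "w \<in> ?top"
      then have "\<not> bad w v" using min[of w v] ab[of w] by auto
      then show "w \<in> ?bot" using w non[of w] V ab[of w] ab[of v] by (auto simp: bad_def left_of_def)
    qed
    with u have "?top \<subset> ?bot" by blast
    then have "card ?top < card ?bot" using finite_V by (intro psubset_card_mono) auto
    with card_eq show False by simp
  qed
  then show ?thesis using adj E_sym unfolding models_def bad_def by blast
qed

lemma counts_agree_if_models:
  assumes place: "placement V a b" "placement V c d" and models: "models V E a b c d" and v: "v \<in> V"
  shows "a v + nbr_ends_before c d v = c v + nbr_ends_before a b v"
proof -
  have sep: "left_of a b c d w v \<or> left_of a b c d v w" if "w \<in> V - closed_nbrs v" for w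
    using that models v E_sym by (auto simp: models_def closed_nbrs_def)
  have lr: "a w < b w" "c w < d w" if "w \<in> V" for w using place that by (auto simp: placement_def)
  have "b w < a v \<longleftrightarrow> d w < c v" if "w \<in> V - closed_nbrs v" for w
    using sep[OF that] lr[of v] lr[of w] that v by (auto simp: left_of_def)
  then have "{w \<in> V - closed_nbrs v. b w < a v} = {w \<in> V - closed_nbrs v. d w < c v}" by blast
  moreover have "a v = 1 + nbr_ends_before a b v + 2 * card {w \<in> V - closed_nbrs v. b w < a v}"
    using sep by (intro left_end_count place v) (auto simp: left_of_def)
  moreover have "c v = 1 + nbr_ends_before c d v + 2 * card {w \<in> V - closed_nbrs v. d w < c v}"
    using sep by (intro left_end_count place v) (auto simp: left_of_def)
  ultimately show ?thesis by simp
qed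

end

section \<open>The verifier\<close>

datatype span = Span (lft: nat) (rgt: nat) (lo: nat) (hi: nat)

text \<open>\<open>subtree_firsts\<close> counts nodes starting at bottom position 1, so that the
  network learns that one exists; on the top line the root itself starts at 1.\<close>

datatype label = Label (root_id: nat) (parent_id: nat) (node_count: nat) (subtree_size: nat)
  (subtree_firsts: nat) (upper: span) (lower: span)

definition span_entries :: "span \<Rightarrow> nat list" where
  "span_entries s = [lft s, rgt s, lo s, hi s]"

definition entries :: "label \<Rightarrow> nat list" where
  "entries x = [root_id x, parent_id x, node_count x, subtree_size x, subtree_firsts x] @
     span_entries (upper x) @ span_entries (lower x)"

lemma length_entries: "length (entries x) = 13"
  by (simp add: entries_def span_entries_def)

lemma inj_entries: "inj entries"
  by (rule injI) (auto simp: entries_def span_entries_def intro!: label.expand span.expand)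

text \<open>This is \<open>line_ok\<close> phrased by what a node sees: its own span and the set of
  its neighbours' spans.\<close>

definition span_ok :: "nat \<Rightarrow> span \<Rightarrow> span set \<Rightarrow> bool" where
  "span_ok m s T \<longleftrightarrow>
     lft s < rgt s \<and> lo s \<le> lft s \<and>
     (\<forall>q\<in>{lo s..rgt s}. \<exists>t\<in>insert s T. q = lft t \<or> q = rgt t) \<and>
     (\<forall>q\<in>{lft s..hi s}. (\<exists>t\<in>insert s T. q = lft t \<or> q = rgt t) \<or> (\<exists>t\<in>T. q \<in> {lo t..rgt t})) \<and>
     (rgt s = m \<or> (\<exists>t\<in>insert s T. lft t \<le> rgt s \<and> rgt s < hi t))"

text \<open>Keeping identifiers in the set stops neighbours with equal labels from being merged in
  the sum.\<close>

definition children_sum :: "(label \<Rightarrow> nat) \<Rightarrow> nat \<Rightarrow> nat \<Rightarrow> (nat \<times> label) set \<Rightarrow> nat" where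
  "children_sum g \<rho> i S = (\<Sum>p\<in>{p \<in> S. fst p \<noteq> \<rho> \<and> parent_id (snd p) = i}. g (snd p))"

definition ends_before :: "(label \<Rightarrow> span) \<Rightarrow> label \<Rightarrow> (nat \<times> label) set \<Rightarrow> nat" where
  "ends_before side x S = card {p \<in> S. lft (side (snd p)) < lft (side x)}
     + card {p \<in> S. rgt (side (snd p)) < lft (side x)}"

definition wholly_left :: "label \<Rightarrow> label \<Rightarrow> bool" where
  "wholly_left x y \<longleftrightarrow> rgt (upper x) < lft (upper y) \<and> rgt (lower x) < lft (lower y)"

definition is_first :: "label \<Rightarrow> nat" where
  "is_first x = (if lft (lower x) = 1 then 1 else 0)"

definition accepts :: "nat \<Rightarrow> label \<Rightarrow> (nat \<times> label) set \<Rightarrow> bool" where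
  "accepts i x S \<longleftrightarrow>
     (\<forall>y\<in>snd ` S. root_id y = root_id x \<and> node_count y = node_count x) \<and>
     (i = root_id x \<longrightarrow> subtree_size x = node_count x \<and> subtree_firsts x = 1 \<and> lft (upper x) = 1) \<and>
     (i \<noteq> root_id x \<longrightarrow> parent_id x \<in> fst ` S) \<and>
     subtree_size x = 1 + children_sum subtree_size (root_id x) i S \<and>
     subtree_firsts x = is_first x + children_sum subtree_firsts (root_id x) i S \<and>
     span_ok (2 * node_count x) (upper x) (upper ` snd ` S) \<and>
     span_ok (2 * node_count x) (lower x) (lower ` snd ` S) \<and>
     (\<forall>y\<in>snd ` S. \<not> wholly_left x y \<and> \<not> wholly_left y x) \<and>
     lft (upper x) + ends_before lower x S = lft (lower x) + ends_before upper x S"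

locale identified_network = network +
  fixes idf :: "nat \<Rightarrow> nat"
  assumes inj_idf: "inj_on idf V"
begin

section \<open>Translating local views into network notions\<close>

definition view :: "(nat \<Rightarrow> label) \<Rightarrow> nat \<Rightarrow> (nat \<times> label) set" where
  "view D v = (\<lambda>w. (idf w, D w)) ` {w. E v w}"

lemma inj_view: "inj_on (\<lambda>w. (idf w, D w)) {w. E v w \<and> P w}"
  using inj_idf E_in_V by (auto simp: inj_on_def)

lemma labels_view: "snd ` view D v = D ` {w. E v w}" and ids_view: "fst ` view D v = idf ` {w. E v w}"
  by (simp_all add: view_def image_image)

lemma filter_view: "{p \<in> view D v. P p} = (\<lambda>w. (idf w, D w)) ` {w. E v w \<and> P (idf w, D w)}"
  by (auto simp: view_def)

lemma children_sum_view:
  "children_sum g \<rho> i (view D v) = (\<Sum>w\<in>{w. E v w \<and> idf w \<noteq> \<rho> \<and> parent_id (D w) = i}. g (D w))"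
  unfolding children_sum_def filter_view by (subst sum.reindex[OF inj_view]) simp

lemma ends_before_view:
  "ends_before side (D v) (view D v) = nbr_ends_before (\<lambda>v. lft (side (D v))) (\<lambda>v. rgt (side (D v))) v"
  unfolding ends_before_def nbr_ends_before_def filter_view by (simp add: card_image[OF inj_view])

lemma span_ok_view:
  "span_ok m (side (D v)) (side ` snd ` view D v) \<longleftrightarrow>
     line_ok m (\<lambda>v. lft (side (D v))) (\<lambda>v. rgt (side (D v))) (\<lambda>v. lo (side (D v))) (\<lambda>v. hi (side (D v))) v"
  unfolding labels_view span_ok_def line_ok_def spots_def closed_nbrs_def by (simp add: image_iff)

lemma trapezoid_graph_if_accepted:
  assumes acc: "\<And>v. v \<in> V \<Longrightarrow> accepts (idf v) (D v) (view D v)"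
  shows "trapezoid_graph V E"
proof -
  let ?a = "\<lambda>v. lft (upper (D v))" and ?b = "\<lambda>v. rgt (upper (D v))"
  let ?c = "\<lambda>v. lft (lower (D v))" and ?d = "\<lambda>v. rgt (lower (D v))"
  note acc' = acc[unfolded accepts_def children_sum_view ends_before_view span_ok_view]
  obtain v0 where v0: "v0 \<in> V" using V_nonempty by blast
  define \<rho> where "\<rho> = root_id (D v0)"
  define m where "m = node_count (D v0)"
  have loc: "root_id (D u) = root_id (D v) \<and> node_count (D u) = node_count (D v)" if "E u v" for u v
    using acc'[of u] that E_in_V by (auto simp: labels_view)
  have \<rho>: "root_id (D v) = \<rho>" if "v \<in> V" for v
    unfolding \<rho>_def using constant_if_locally_constant[of "\<lambda>v. root_id (D v)"] loc that v0 by blast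
  have m: "node_count (D v) = m" if "v \<in> V" for v
    unfolding m_def using constant_if_locally_constant[of "\<lambda>v. node_count (D v)"] loc that v0 by blast
  let ?R = "{w. idf w = \<rho>}"
  \<comment> \<open>Labels name the parent by identifier; injectivity of \<open>idf\<close> recovers
    the node.\<close>
  define parent where "parent v = inv_into V idf (parent_id (D v))" for v
  have parent: "E v (parent v) \<and> parent_id (D v) = idf (parent v)" if "v \<in> V" "v \<notin> ?R" for v
  proof -
    have "parent_id (D v) \<in> idf ` {w. E v w}"
      using acc'[OF that(1)] that \<rho> by (auto simp: ids_view)
    then obtain w where "E v w" "parent_id (D v) = idf w" by blast
    then show ?thesis using inj_idf E_in_V by (auto simp: parent_def)
  qed
  have children: "{w. E v w \<and> idf w \<noteq> \<rho> \<and> parent_id (D w) = idf v} = {w. E v w \<and> w \<notin> ?R \<and> parent w = v}"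
    if "v \<in> V" for v
  proof -
    have "parent_id (D w) = idf v \<longleftrightarrow> parent w = v" if "E v w" "idf w \<noteq> \<rho>" for w
      using parent[of w] that E_in_V inj_onD[OF inj_idf] by (metis mem_Collect_eq)
    then show ?thesis by auto
  qed
  have size: "sum (\<lambda>v. subtree_size (D v)) (V \<inter> ?R) = sum (\<lambda>_. 1) V"
    using parent acc' children \<rho> by (intro aggregation_sound[where parent = parent]) auto
  have firsts: "sum (\<lambda>v. subtree_firsts (D v)) (V \<inter> ?R) = sum (\<lambda>v. is_first (D v)) V"
    using parent acc' children \<rho> by (intro aggregation_sound[where parent = parent]) auto
  \<comment> \<open>That some node carries the claimed root identifier is itself certified:
    otherwise the left sum in \<open>size\<close> would be empty, yet it equals
    \<open>card V\<close>.\<close>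
  have "V \<inter> ?R \<noteq> {}" using size finite_V V_nonempty by auto
  then obtain r where r: "r \<in> V" "idf r = \<rho>" by blast
  then have R: "V \<inter> ?R = {r}" using inj_onD[OF inj_idf] by auto
  have m_card: "m = card V" using size R acc'[OF r(1)] r \<rho> m by simp
  have "sum (\<lambda>v. is_first (D v)) V = 1" using firsts R acc'[OF r(1)] r \<rho> by simp
  then obtain r' where r': "r' \<in> V" "?c r' = 1"
    by (metis (no_types, lifting) is_first_def sum.neutral zero_neq_one)
  have lines: "line_ok (2 * card V) ?a ?b (\<lambda>v. lo (upper (D v))) (\<lambda>v. hi (upper (D v))) v"
    "line_ok (2 * card V) ?c ?d (\<lambda>v. lo (lower (D v))) (\<lambda>v. hi (lower (D v))) v" if "v \<in> V" for v
    using acc'[OF that] m[OF that] m_card by simp_all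
  have "?a r = 1" using acc'[OF r(1)] r \<rho> by simp
  then have place: "placement V ?a ?b" "placement V ?c ?d"
    using placement_if_line_ok[OF lines(1) r(1)] placement_if_line_ok[OF lines(2) r'(1)] r'(2) by blast+
  have "models V E ?a ?b ?c ?d"
  proof (rule models_if_counts_agree[OF place])
    show "?b u < ?a v \<or> ?b v < ?a u" if "u \<in> V" "v \<in> V" "u \<noteq> v" "\<not> E u v" for u v
      by (rule nonnbrs_disjoint_if_line_ok[OF place(1) lines(1) that])
    show "?d u < ?c v \<or> ?d v < ?c u" if "u \<in> V" "v \<in> V" "u \<noteq> v" "\<not> E u v" for u v
      by (rule nonnbrs_disjoint_if_line_ok[OF place(2) lines(2) that])
    show "\<not> left_of ?a ?b ?c ?d u v" if "E u v" for u v
      using acc'[of u] that E_in_V by (auto simp: labels_view wholly_left_def left_of_def)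
  qed (use acc' in blast)
  with place show ?thesis using trapezoid_graph_iff_placement[OF finite_V] by blast
qed

lemma accepted_if_trapezoid_graph:
  assumes "trapezoid_graph V E"
  shows "\<exists>D. \<forall>v\<in>V. accepts (idf v) (D v) (view D v) \<and> set (entries (D v)) \<subseteq> {..2 * card V} \<union> idf ` V"
proof -
  let ?m = "2 * card V"
  obtain a b c d where place: "placement V a b" "placement V c d" and models: "models V E a b c d"
    using assms trapezoid_graph_iff_placement[OF finite_V] by blast
  have ab: "a v < b v" "c v < d v" if "v \<in> V" for v using place that by (auto simp: placement_def)
  have range: "l v \<in> {1..?m} \<and> r v \<in> {1..?m}" if "placement V l r" "v \<in> V" for l r v
  proof -
    have "endpoint l r (v, i) \<in> {1..?m}" for i
      using that by (auto simp: placement_def dest!: bij_betwE)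
    from this[of True] this[of False] show ?thesis by simp
  qed
  \<comment> \<open>Position 1 is a left end, since every right end has its left end before it;
    injectivity makes its holder unique.\<close>
  have first: "\<exists>v\<in>V. l v = 1 \<and> (\<forall>w\<in>V. l w = 1 \<longrightarrow> w = v)" if pl: "placement V l r" for l r
  proof -
    have bij: "bij_betw (endpoint l r) (V \<times> UNIV) {1..?m}" using pl by (simp add: placement_def)
    have "1 \<in> {1..?m}" using V_nonempty finite_V by (simp add: Suc_le_eq card_gt_0_iff)
    then have "1 \<in> endpoint l r ` (V \<times> UNIV)" using bij by (simp only: bij_betw_def)
    then obtain v i where v: "v \<in> V" "endpoint l r (v, i) = 1" by force
    have "l v < r v" "1 \<le> l v" using pl range[OF pl v(1)] v(1) by (auto simp: placement_def)
    then have "l v = 1" using v(2) by (cases i) auto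
    moreover have "w = v" if "w \<in> V" "l w = 1" for w
      using inj_onD[OF bij_betw_imp_inj_on[OF bij], of "(w, False)" "(v, False)"] that v(1) \<open>l v = 1\<close> by simp
    ultimately show ?thesis using v(1) by blast
  qed
  obtain r where r: "r \<in> V" "a r = 1" using first[OF place(1)] by blast
  obtain r' where r': "r' \<in> V" "c r' = 1" "\<And>w. w \<in> V \<Longrightarrow> c w = 1 \<Longrightarrow> w = r'"
    using first[OF place(2)] by blast
  obtain lo\<^sub>1 hi\<^sub>1 where upper: "\<forall>v\<in>V. lo\<^sub>1 v \<le> ?m \<and> hi\<^sub>1 v \<le> ?m \<and> line_ok ?m a b lo\<^sub>1 hi\<^sub>1 v"
    using line_ok_if_models[OF place(1) _ models] ab by blast
  obtain lo\<^sub>2 hi\<^sub>2 where lower: "\<forall>v\<in>V. lo\<^sub>2 v \<le> ?m \<and> hi\<^sub>2 v \<le> ?m \<and> line_ok ?m c d lo\<^sub>2 hi\<^sub>2 v"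
    using line_ok_if_models[OF place(2) _ models_swap[OF models]] ab by blast
  obtain parent where parent: "\<forall>v\<in>V - {r}. E v (parent v)"
    and agg: "\<And>f :: nat \<Rightarrow> nat. \<exists>s. s r = sum f V \<and>
      (\<forall>v\<in>V. s v \<le> sum f V \<and> s v = f v + sum s {w. E v w \<and> w \<noteq> r \<and> parent w = v})"
    using aggregation_exists[OF r(1)] by blast
  obtain s where s: "s r = card V"
    "\<forall>v\<in>V. s v \<le> card V \<and> s v = 1 + sum s {w. E v w \<and> w \<noteq> r \<and> parent w = v}"
    using agg[of "\<lambda>_. 1", folded card_eq_sum] by (elim exE conjE) (rule that)
  let ?first = "\<lambda>v. if c v = 1 then 1 else 0 :: nat"
  have "c v = 1 \<longleftrightarrow> v = r'" if "v \<in> V" for v using r' that by blast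
  then have "sum ?first V = (\<Sum>v\<in>V. if v = r' then 1 else 0)" by (intro sum.cong refl) (simp only:)
  then have sum_first: "sum ?first V = 1" using finite_V r'(1) by simp
  obtain t where t: "t r = 1"
    "\<forall>v\<in>V. t v \<le> 1 \<and> t v = ?first v + sum t {w. E v w \<and> w \<noteq> r \<and> parent w = v}"
    using agg[of ?first] unfolding sum_first by (elim exE conjE) (rule that)
  \<comment> \<open>\<open>parent r\<close> is unspecified, so the root stores its own identifier,
    which keeps this entry within the size bound.\<close>
  define D where "D v = Label (idf r) (if v = r then idf r else idf (parent v)) (card V) (s v) (t v)
    (Span (a v) (b v) (lo\<^sub>1 v) (hi\<^sub>1 v)) (Span (c v) (d v) (lo\<^sub>2 v) (hi\<^sub>2 v))" for v
  have root_D: "root_id (D v) = idf r" for v by (simp add: D_def)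
  have root: "idf v = idf r \<longleftrightarrow> v = r" if "v \<in> V" for v
    using inj_onD[OF inj_idf] r that by blast
  have children: "{w. E v w \<and> idf w \<noteq> idf r \<and> parent_id (D w) = idf v} = {w. E v w \<and> w \<noteq> r \<and> parent w = v}"
    if v: "v \<in> V" for v
  proof -
    have "idf w \<noteq> idf r \<and> parent_id (D w) = idf v \<longleftrightarrow> w \<noteq> r \<and> parent w = v" if "E v w" for w
    proof (cases "w = r")
      case False
      then have "w \<in> V" "parent w \<in> V" using that E_in_V parent by blast+
      then show ?thesis using False root v inj_onD[OF inj_idf] by (auto simp: D_def)
    qed simp
    then show ?thesis by blast
  qed
  have "accepts (idf v) (D v) (view D v)" if v: "v \<in> V" for v
  proof -
    have sizes: "subtree_size (D v) = 1 + children_sum subtree_size (root_id (D v)) (idf v) (view D v)"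
      "subtree_firsts (D v) = is_first (D v) + children_sum subtree_firsts (root_id (D v)) (idf v) (view D v)"
      using bspec[OF s(2) v] bspec[OF t(2) v] unfolding children_sum_view root_D children[OF v]
      by (simp_all add: D_def is_first_def)
    have lines: "span_ok (2 * node_count (D v)) (upper (D v)) (upper ` snd ` view D v)"
      "span_ok (2 * node_count (D v)) (lower (D v)) (lower ` snd ` view D v)"
      using upper lower v unfolding span_ok_view by (auto simp: D_def)
    have counts: "lft (upper (D v)) + ends_before lower (D v) (view D v)
        = lft (lower (D v)) + ends_before upper (D v) (view D v)"
      using counts_agree_if_models[OF place models v] unfolding ends_before_view by (simp add: D_def)
    have "\<not> left_of a b c d v w \<and> \<not> left_of a b c d w v" if "E v w" for w
      using models that v E_in_V(2)[OF that] E_irrefl unfolding models_def by metis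
    then have meet: "\<forall>y\<in>snd ` view D v. \<not> wholly_left (D v) y \<and> \<not> wholly_left y (D v)"
      unfolding labels_view by (auto simp: D_def wholly_left_def left_of_def)
    have "\<forall>y\<in>snd ` view D v. root_id y = root_id (D v) \<and> node_count y = node_count (D v)"
      unfolding labels_view by (auto simp: D_def)
    moreover have "idf v = root_id (D v) \<longrightarrow>
        subtree_size (D v) = node_count (D v) \<and> subtree_firsts (D v) = 1 \<and> lft (upper (D v)) = 1"
      using root[OF v] s(1) t(1) r(2) by (auto simp: D_def)
    moreover have "idf v \<noteq> root_id (D v) \<longrightarrow> parent_id (D v) \<in> fst ` view D v"
      using parent v unfolding ids_view by (auto simp: D_def)
    ultimately show ?thesis unfolding accepts_def using sizes lines counts meet by blast
  qed
  moreover have "set (entries (D v)) \<subseteq> {..?m} \<union> idf ` V" if v: "v \<in> V" for v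
  proof -
    have "1 \<le> card V" using V_nonempty finite_V by (simp add: Suc_le_eq card_gt_0_iff)
    moreover have "s v \<le> card V" "t v \<le> 1" using bspec[OF s(2) v] bspec[OF t(2) v] by blast+
    ultimately have "s v \<le> ?m" "t v \<le> ?m" by linarith+
    moreover have "v \<noteq> r \<Longrightarrow> parent v \<in> V" using parent v E_in_V by blast
    ultimately show ?thesis
      using v r(1) range[OF place(1) v] range[OF place(2) v] upper lower
      by (auto simp: entries_def span_entries_def D_def)
  qed
  ultimately show ?thesis by blast
qed

end

section \<open>Encoding labels as bit strings\<close>

text \<open>Counting replaces an explicit code: there are as many lists of 13 numbers below
  \<open>2 ^ K\<close> as bit strings of length \<open>13 * K\<close>.\<close>

lemma label_code_exists:
  "\<exists>enc :: label \<Rightarrow> bool list. inj_on enc {x. set (entries x) \<subseteq> {..<2 ^ K}} \<and>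
     (\<forall>x. set (entries x) \<subseteq> {..<2 ^ K} \<longrightarrow> length (enc x) = 13 * K)"
proof -
  let ?A = "{xs :: nat list. set xs \<subseteq> {..<2 ^ K} \<and> length xs = 13}"
  let ?B = "{xs :: bool list. set xs \<subseteq> UNIV \<and> length xs = 13 * K}"
  have "card ?A = (2 ^ K) ^ 13" by (subst card_lists_length_eq) auto
  also have "\<dots> = (2 :: nat) ^ (13 * K)" by (simp add: power_mult[symmetric] mult.commute)
  also have "\<dots> = card ?B" by (subst card_lists_length_eq) auto
  finally have "card ?A = card ?B" .
  moreover have "finite ?A" "finite ?B" by (intro finite_lists_length_eq; simp)+
  ultimately obtain f where f: "bij_betw f ?A ?B" using finite_same_card_bij by blast
  let ?L = "{x. set (entries x) \<subseteq> {..<2 ^ K}}"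
  have "entries ` ?L \<subseteq> ?A" using length_entries by auto
  then have "inj_on f (entries ` ?L)" using f by (auto simp: bij_betw_def intro: inj_on_subset)
  then have "inj_on (f \<circ> entries) ?L"
    by (intro comp_inj_on inj_on_subset[OF inj_entries]) auto
  moreover have "length (f (entries x)) = 13 * K" if "set (entries x) \<subseteq> {..<2 ^ K}" for x
    using bij_betwE[OF f] that length_entries[of x] by auto
  ultimately show ?thesis by (intro exI[of _ "f \<circ> entries"]) auto
qed

section \<open>Field widths and the logarithmic bound\<close>

definition bits :: "nat \<Rightarrow> nat" where
  "bits N = nat \<lceil>log 2 (real N + 1)\<rceil>"

lemma Suc_le_two_power_bits: "N + 1 \<le> 2 ^ bits N"
proof -
  have "log 2 (real N + 1) \<le> real (bits N)" unfolding bits_def by linarith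
  then have "2 powr log 2 (real N + 1) \<le> 2 powr real (bits N)" by (intro powr_mono) auto
  then have "real N + 1 \<le> 2 powr real (bits N)" by (subst (asm) powr_log_cancel) auto
  also have "\<dots> = real (2 ^ bits N)" by (simp add: powr_realpow)
  finally have "real (N + 1) \<le> real (2 ^ bits N)" by simp
  then show ?thesis by (subst (asm) of_nat_le_iff)
qed

text \<open>Since \<open>n + 1\<close> is at least 2, one extra factor absorbs the increment of
  \<open>N\<close>, and one extra logarithm absorbs the rounding; hence
  \<open>k + 2\<close>.\<close>

lemma bits_le:
  assumes "N \<le> (n + 1) ^ k" "1 \<le> n"
  shows "real (bits N) \<le> real (k + 2) * log 2 (real n + 1)"
proof -
  have "real N + 1 \<le> (real n + 1) ^ k + 1"
    using assms(1) by (metis add_right_mono of_nat_1 of_nat_add of_nat_le_iff of_nat_power)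
  also have "\<dots> \<le> (real n + 1) ^ k * 2" using one_le_power[of "real n + 1" k] by simp
  also have "\<dots> \<le> (real n + 1) ^ k * (real n + 1)" using assms(2) by (intro mult_left_mono) auto
  finally have "real N + 1 \<le> (real n + 1) ^ (k + 1)" by (simp add: mult.commute)
  then have "log 2 (real N + 1) \<le> log 2 ((real n + 1) ^ (k + 1))" by (subst log_le_cancel_iff) auto
  also have "\<dots> = real (k + 1) * log 2 (real n + 1)" by (subst log_nat_power) auto
  finally have "log 2 (real N + 1) \<le> real (k + 1) * log 2 (real n + 1)" .
  moreover have "0 \<le> log 2 (real N + 1)" by simp
  then have "real (bits N) \<le> log 2 (real N + 1) + 1" unfolding bits_def by linarith
  moreover have "1 \<le> log 2 (real n + 1)" using assms(2) by (subst one_le_log_cancel_iff) auto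
  moreover have "real (k + 2) * log 2 (real n + 1) = real (k + 1) * log 2 (real n + 1) + log 2 (real n + 1)"
    by (simp add: algebra_simps)
  ultimately show ?thesis by linarith
qed

theorem theorem2:
  fixes k :: nat
  shows "\<exists>(ver :: verifier) (C :: real).
     \<forall>V E idf N. admissible k V E idf N \<longrightarrow>
       (trapezoid_graph V E \<longrightarrow>
          (\<exists>cert. (\<forall>v\<in>V. real (length (cert v)) \<le> C * log 2 (real (card V) + 1))
                  \<and> all_accept ver N V E idf cert)) \<and>
       (\<not> trapezoid_graph V E \<longrightarrow> (\<forall>cert. \<not> all_accept ver N V E idf cert))"
proof -
  obtain enc :: "nat \<Rightarrow> label \<Rightarrow> bool list" where
    enc: "\<And>K. inj_on (enc K) {x. set (entries x) \<subseteq> {..<2 ^ K}}"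
      "\<And>K x. set (entries x) \<subseteq> {..<2 ^ K} \<Longrightarrow> length (enc K x) = 13 * K"
    using label_code_exists by metis
  \<comment> \<open>The verifier knows only \<open>N\<close>, so the width depends on
    \<open>N\<close>. Every entry is at most \<open>2 * N\<close> or \<open>(N + 1) ^ k\<close>,
    hence below \<open>(N + 1) ^ (k + 2)\<close>.\<close>
  define K where "K N = (k + 2) * bits N" for N
  define dec where "dec N = inv_into {x. set (entries x) \<subseteq> {..<2 ^ K N}} (enc (K N))" for N
  \<comment> \<open>On a string that encodes no label, \<open>dec\<close> returns an arbitrary label; soundness holds for all labels.\<close>
  define ver :: verifier where "ver N i c S = accepts i (dec N c) ((\<lambda>(j, c). (j, dec N c)) ` S)" for N i c S
  \<comment> \<open>There are 13 fields; one factor \<open>k + 2\<close> comes from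
    \<open>K\<close>, the other from \<open>bits_le\<close>.\<close>
  define C where "C = 13 * (real (k + 2))\<^sup>2"
  show ?thesis
  proof (intro exI[of _ ver] exI[of _ C] allI impI)
    fix V E idf N assume adm: "admissible k V E idf N"
    interpret identified_network V E idf
      using adm by unfold_locales (auto simp: admissible_def)
    have view: "(\<lambda>(j, c). (j, dec N c)) ` nbr_view E idf cert v = view (\<lambda>v. dec N (cert v)) v" for cert v
      by (force simp: nbr_view_def view_def image_iff)
    have ver: "all_accept ver N V E idf cert \<longleftrightarrow>
        (\<forall>v\<in>V. accepts (idf v) (dec N (cert v)) (view (\<lambda>v. dec N (cert v)) v))" for cert
      by (simp add: all_accept_def ver_def view)
    have n: "1 \<le> card V" "card V \<le> N" "N \<le> (card V + 1) ^ k"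
      and ids: "\<And>v. v \<in> V \<Longrightarrow> idf v \<le> (card V + 1) ^ k"
      using adm V_nonempty finite_V by (auto simp: admissible_def Suc_le_eq card_gt_0_iff)
    have small: "x < 2 ^ K N" if "x \<in> {..2 * card V} \<union> idf ` V" for x
    proof -
      have "x \<le> 2 * N \<or> x \<le> (N + 1) ^ k"
        using that n ids power_mono[of "card V + 1" "N + 1" k] by fastforce
      moreover have "(N + 1) ^ k * (N + 1)\<^sup>2 \<ge> 1 * (N + 1)\<^sup>2" by (intro mult_right_mono) auto
      moreover have "(N + 1)\<^sup>2 > 2 * N" by (simp add: power2_eq_square)
      moreover have "(N + 1) ^ k * (N + 1)\<^sup>2 > (N + 1) ^ k * 1"
        using n by (intro mult_strict_left_mono) (auto simp: power2_eq_square)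
      ultimately have "x < (N + 1) ^ (k + 2)" by (simp only: power_add) linarith
      also have "\<dots> \<le> (2 ^ bits N) ^ (k + 2)" by (intro power_mono Suc_le_two_power_bits) auto
      also have "\<dots> = 2 ^ K N" by (simp only: K_def power_mult[symmetric] mult.commute)
      finally show ?thesis .
    qed
    show "(trapezoid_graph V E \<longrightarrow>
          (\<exists>cert. (\<forall>v\<in>V. real (length (cert v)) \<le> C * log 2 (real (card V) + 1))
                  \<and> all_accept ver N V E idf cert)) \<and>
       (\<not> trapezoid_graph V E \<longrightarrow> (\<forall>cert. \<not> all_accept ver N V E idf cert))"
    proof (intro conjI impI allI)
      assume "trapezoid_graph V E"
      then obtain D where D: "\<And>v. v \<in> V \<Longrightarrow> accepts (idf v) (D v) (view D v)"
          "\<And>v. v \<in> V \<Longrightarrow> set (entries (D v)) \<subseteq> {..2 * card V} \<union> idf ` V"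
        using accepted_if_trapezoid_graph by blast
      define cert where "cert v = enc (K N) (D v)" for v
      have entries: "set (entries (D v)) \<subseteq> {..<2 ^ K N}" if "v \<in> V" for v
        using D(2)[OF that] small by blast
      have dec: "dec N (cert v) = D v" if "v \<in> V" for v
        unfolding dec_def cert_def using enc(1) entries[OF that] by (intro inv_into_f_f) auto
      have "view (\<lambda>v. dec N (cert v)) v = view D v" for v
        unfolding view_def using dec E_in_V by (intro image_cong) auto
      then have "all_accept ver N V E idf cert" using D(1) dec by (simp add: ver)
      moreover have "real (length (cert v)) \<le> C * log 2 (real (card V) + 1)" if "v \<in> V" for v
      proof -
        have "real (length (cert v)) = 13 * real (k + 2) * real (bits N)"
          using enc(2)[OF entries[OF that]] unfolding cert_def K_def by (simp only: of_nat_mult of_nat_numeral mult.assoc)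
        also have "\<dots> \<le> 13 * real (k + 2) * (real (k + 2) * log 2 (real (card V) + 1))"
          using bits_le[OF n(3,1)] by (intro mult_left_mono) auto
        finally show ?thesis by (simp only: C_def power2_eq_square mult.assoc)
      qed
      ultimately show "\<exists>cert. (\<forall>v\<in>V. real (length (cert v)) \<le> C * log 2 (real (card V) + 1))
          \<and> all_accept ver N V E idf cert" by blast
    next
      fix cert assume "\<not> trapezoid_graph V E"
      then show "\<not> all_accept ver N V E idf cert"
        using trapezoid_graph_if_accepted[of "\<lambda>v. dec N (cert v)"] ver by blast
    qed
  qed
qed

end
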